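(* Let $F$ be a field with $\operatorname{char}F\ne2$, $D$ a finite-dimensional central division $F$-algebra with involution $\ast$, $\eta\in F$ with $\eta\eta^\ast=1$, $n\ge1$, $A\in M_n(D)$ invertible with $\eta A^\ast=A$ (where $[x_{ij}]^\ast=[x_{ji}^\ast]$), and $X^\#=A^{-1}X^\ast A$. If $\eta\neq-1$ or $\ast|_D\neq\mathrm{id}$, then the following are equivalent: (1) $\#$ is formally real on $M_n(D)$; (2) there exists a $1$-hermitian cone on $(M_n(D),\#)$ containing the identity matrix $I$; (3) there exists an $\eta$-hermitian cone on $(M_n(D),\ast)$ containing $A$; (4) there exist an invertible $P\in M_n(D)$ with $P^\ast AP=\mathrm{diag}(d_1,\dots,d_n)$ and an $\eta$-hermitian cone on $(D,\ast)$ containing $d_1,\dots,d_n$. If $\eta=-1$ and $\ast|_D=\mathrm{id}$, then $\#$ is not formally real.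
   Context: An involution $\#$ on a ring $R$ is formally real if every finite sum of nonzero elements of the form $rr^\#$ ($r\in R$) is nonzero. For a ring $R$ with involution $\ast$ whose center contains $F$ with $F^\ast\subseteq F$, and $\varepsilon\in F$ with $\varepsilon\varepsilon^\ast=1$, an element $a\in R$ is $\varepsilon$-hermitian if $\varepsilon a^\ast=a$; $S_\varepsilon(R)$ is the set of such elements. An $\varepsilon$-hermitian cone on $(R,\ast)$ is a subset $M\subseteq S_\varepsilon(R)$ with $M+M\subseteq M$, $aMa^\ast\subseteq M$ for every $a\in R$, and $M\cap-M=\{0\}$. *)

theory Defs
  imports "HOL-Analysis.Analysis"
begin

text \<open>An involution on a (possibly noncommutative) ring: additive anti-automorphism of order 2.\<close>
definition is_involution :: "('a::ring_1 \<Rightarrow> 'a) \<Rightarrow> bool" where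
  "is_involution s \<longleftrightarrow> (\<forall>x y. s (x + y) = s x + s y) \<and> (\<forall>x y. s (x * y) = s y * s x)
      \<and> (\<forall>x. s (s x) = x)"

text \<open>The center of a ring.\<close>
definition center :: "'a::ring_1 set" where
  "center = {z. \<forall>x. z * x = x * z}"

text \<open>D is finite-dimensional (as a left vector space) over its center F.\<close>
definition fin_dim_over_center :: "'a::ring_1 itself \<Rightarrow> bool" where
  "fin_dim_over_center _ \<longleftrightarrow> (\<exists>B::'a set. finite B \<and>
      (\<forall>x. \<exists>c. (\<forall>b\<in>B. c b \<in> center) \<and> x = (\<Sum>b\<in>B. c b * b)))"

text \<open>Generic ring notions, parametrised by the multiplication (so that they can be applied
  both to D and to matrices over D, where multiplication is the matrix product).\<close>

definition formally_real :: "('r::ab_group_add \<Rightarrow> 'r \<Rightarrow> 'r) \<Rightarrow> ('r \<Rightarrow> 'r) \<Rightarrow> bool" where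
  "formally_real mul invl \<longleftrightarrow>
     (\<forall>xs. xs \<noteq> [] \<and> (\<forall>x\<in>set xs. mul x (invl x) \<noteq> 0)
        \<longrightarrow> sum_list (map (\<lambda>x. mul x (invl x)) xs) \<noteq> 0)"

definition herm_set :: "('r \<Rightarrow> 'r \<Rightarrow> 'r) \<Rightarrow> ('r \<Rightarrow> 'r) \<Rightarrow> 'r \<Rightarrow> 'r set" where
  "herm_set mul invl \<epsilon> = {a. mul \<epsilon> (invl a) = a}"

definition herm_cone :: "('r::ab_group_add \<Rightarrow> 'r \<Rightarrow> 'r) \<Rightarrow> ('r \<Rightarrow> 'r) \<Rightarrow> 'r \<Rightarrow> 'r set \<Rightarrow> bool" where
  "herm_cone mul invl \<epsilon> M \<longleftrightarrow> M \<subseteq> herm_set mul invl \<epsilon>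
     \<and> (\<forall>x\<in>M. \<forall>y\<in>M. x + y \<in> M)
     \<and> (\<forall>a. \<forall>m\<in>M. mul (mul a m) (invl a) \<in> M)
     \<and> M \<inter> uminus ` M = {0}"

text \<open>Conjugate transpose of a matrix over D: [x_ij]^* = [x_ji^*].\<close>
definition mstar :: "('d \<Rightarrow> 'd) \<Rightarrow> 'd^'n^'n \<Rightarrow> 'd^'n^'n" where
  "mstar s X = (\<chi> i j. s (X $ j $ i))"

definition diag_mat :: "('n::finite \<Rightarrow> 'd::zero) \<Rightarrow> 'd^'n^'n" where
  "diag_mat d = (\<chi> i j. if i = j then d i else 0)"

end

theory Submission
  imports Defs
begin

(*
  Proof idea.  Call a set G of elements of a ring with involution J anisotropic if a finite sum
  of terms x g x^J (g in G) vanishes only when every summand does.  All four conditions of the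
  theorem are reformulated in terms of this one notion:
  (a) J is formally real iff {1} is anisotropic; for e-hermitian G (e central), G lies in an
      e-hermitian cone iff G is anisotropic -- the cone being all such sums.  This is developed
      for an abstract unital ring with involution (locale ring_involution), and gives (1)<->(2).
  (b) For X# = A^-1 X* A, the substitution X = Y A shows that {1} is anisotropic for # iff {A}
      is anisotropic for *; with (a) this gives (1)<->(3).
  (c) Unless eta = -1 and * = id, symmetric Gaussian elimination diagonalises every
      eta-hermitian matrix by a congruence; anisotropy of diag(d) is equivalent to the d_i lying
      in an eta-hermitian cone of D (embedding D into a matrix corner).  This gives (1)<->(4).
  (d) If eta = -1 and * = id, A is alternating and two row selections of A cancel, so {A} is
      not anisotropic and # is not formally real.
*)

section \<open>Vanishing sums and anisotropy\<close>

text \<open>\<open>nonvanishing_sums D q\<close>: a finite sum of values of \<open>q\<close> on \<open>D\<close> vanishes only if every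
  summand does.  All positivity notions of the theorem are instances of this.\<close>
definition nonvanishing_sums :: "'x set \<Rightarrow> ('x \<Rightarrow> 'r::monoid_add) \<Rightarrow> bool" where
  "nonvanishing_sums D q \<longleftrightarrow>
     (\<forall>xs. set xs \<subseteq> D \<longrightarrow> sum_list (map q xs) = 0 \<longrightarrow> (\<forall>x\<in>set xs. q x = 0))"

text \<open>Transport along a reparametrisation \<open>h\<close> and an additive map \<open>K\<close> with trivial kernel.\<close>
lemma nonvanishing_sums_pullback:
  fixes q1 :: "'x \<Rightarrow> 'r::ab_group_add" and q2 :: "'y \<Rightarrow> 's::ab_group_add"
  assumes nv: "nonvanishing_sums D2 q2" and h: "h ` D1 \<subseteq> D2"
    and q: "\<And>y. y \<in> D1 \<Longrightarrow> q2 (h y) = K (q1 y)"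
    and K_add: "\<And>a b. K (a + b) = K a + K b" and K_inj: "\<And>a. K a = 0 \<Longrightarrow> a = 0"
  shows "nonvanishing_sums D1 q1"
  unfolding nonvanishing_sums_def
proof (intro allI impI ballI)
  fix ys y assume ys: "set ys \<subseteq> D1" and sum0: "sum_list (map q1 ys) = 0" and y: "y \<in> set ys"
  have K0: "K 0 = 0" using K_add[of 0 0] add_cancel_right_right[of "K 0" "K 0"] by simp
  have "sum_list (map q2 (map h ys)) = K (sum_list (map q1 ys))"
    using ys by (induction ys) (simp_all add: K0 K_add q)
  hence "sum_list (map q2 (map h ys)) = 0" using sum0 K0 by simp
  moreover have "set (map h ys) \<subseteq> D2" using ys h by auto
  ultimately have "\<forall>z\<in>set (map h ys). q2 z = 0"
    using nv unfolding nonvanishing_sums_def by blast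
  hence "q2 (h y) = 0" using y by simp
  thus "q1 y = 0" using q ys y K_inj by auto
qed

text \<open>Formal reality is the special case \<open>q x = x x\<^sup>J\<close> on the whole ring (zero summands can be
  dropped from a sum).\<close>
lemma formally_real_iff_nonvanishing:
  "formally_real mul J \<longleftrightarrow> nonvanishing_sums UNIV (\<lambda>x. mul x (J x))"
proof -
  let ?q = "\<lambda>x. mul x (J x)"
  have drop_zeros: "sum_list (map ?q xs) = sum_list (map ?q (filter (\<lambda>x. ?q x \<noteq> 0) xs))" for xs
    by (induction xs) auto
  show ?thesis unfolding formally_real_def nonvanishing_sums_def
  proof safe
    fix xs x assume fr: "\<forall>xs. xs \<noteq> [] \<and> (\<forall>x\<in>set xs. ?q x \<noteq> 0) \<longrightarrow> sum_list (map ?q xs) \<noteq> 0"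
      and sum0: "sum_list (map ?q xs) = 0" and x: "x \<in> set xs"
    show "?q x = 0"
    proof (rule ccontr)
      assume "?q x \<noteq> 0"
      hence "filter (\<lambda>x. ?q x \<noteq> 0) xs \<noteq> []" using x by (induction xs) auto
      thus False using fr[rule_format, of "filter (\<lambda>x. ?q x \<noteq> 0) xs"] sum0 drop_zeros[of xs] by auto
    qed
  next
    fix xs assume "\<forall>xs. set xs \<subseteq> UNIV \<longrightarrow> sum_list (map ?q xs) = 0 \<longrightarrow> (\<forall>x\<in>set xs. ?q x = 0)"
      "xs \<noteq> []" "\<forall>x\<in>set xs. ?q x \<noteq> 0" "sum_list (map ?q xs) = 0"
    thus False by (cases xs) auto
  qed
qed

text \<open>A set \<open>G\<close> is anisotropic for \<open>(mul, J)\<close> if sums of terms \<open>x g x\<^sup>J\<close> (\<open>g \<in> G\<close>) vanish only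
  trivially.\<close>
definition anisotropic :: "('r::ab_group_add \<Rightarrow> 'r \<Rightarrow> 'r) \<Rightarrow> ('r \<Rightarrow> 'r) \<Rightarrow> 'r set \<Rightarrow> bool" where
  "anisotropic mul J G \<longleftrightarrow> nonvanishing_sums (G \<times> UNIV) (\<lambda>(g, x). mul (mul x g) (J x))"

text \<open>For a single element the weights can be dropped: \<open>{c}\<close> is anisotropic iff sums of
  \<open>x c x\<^sup>J\<close> vanish only trivially.\<close>
lemma anisotropic_singleton:
  "anisotropic mul J {c} \<longleftrightarrow> nonvanishing_sums UNIV (\<lambda>x. mul (mul x c) (J x))"
  unfolding anisotropic_def
proof
  assume "nonvanishing_sums ({c} \<times> UNIV) (\<lambda>(g, x). mul (mul x g) (J x))"
  thus "nonvanishing_sums UNIV (\<lambda>x. mul (mul x c) (J x))"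
    by (rule nonvanishing_sums_pullback[where h = "Pair c" and K = id]) auto
next
  assume "nonvanishing_sums UNIV (\<lambda>x. mul (mul x c) (J x))"
  thus "nonvanishing_sums ({c} \<times> UNIV) (\<lambda>(g, x). mul (mul x g) (J x))"
    by (rule nonvanishing_sums_pullback[where h = snd and K = id]) auto
qed

section \<open>Hermitian cones\<close>

lemma herm_cone_zero: "herm_cone mul J e M \<Longrightarrow> 0 \<in> M"
  unfolding herm_cone_def by blast

text \<open>Elementary consequences of the cone axioms, for an arbitrary multiplication.\<close>
lemma herm_cone_congruence: "herm_cone mul J e M \<Longrightarrow> m \<in> M \<Longrightarrow> mul (mul a m) (J a) \<in> M"
  unfolding herm_cone_def by blast

lemma herm_cone_sum_list: "herm_cone mul J e M \<Longrightarrow> set xs \<subseteq> M \<Longrightarrow> sum_list xs \<in> M"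
  by (induction xs) (auto simp: herm_cone_zero, auto simp: herm_cone_def)

text \<open>Pointedness: \<open>x\<close> and \<open>-x\<close> both in the cone forces \<open>x = 0\<close>.\<close>
lemma herm_cone_antisym:
  assumes C: "herm_cone mul J e M" and "x \<in> M" "- x \<in> M" shows "x = 0"
proof -
  have "x \<in> M \<inter> uminus ` M" using assms(2,3) by (metis IntI image_eqI minus_minus)
  thus ?thesis using C unfolding herm_cone_def by auto
qed

text \<open>The defining property of a cone: a vanishing sum of its elements has vanishing summands.\<close>
lemma herm_cone_sum_list_zero:
  assumes C: "herm_cone mul J e M"
  shows "set xs \<subseteq> M \<Longrightarrow> sum_list xs = 0 \<Longrightarrow> x \<in> set xs \<Longrightarrow> x = 0"
proof (induction xs)
  case (Cons a xs)
  have aM: "a \<in> M" and xsM: "set xs \<subseteq> M" using Cons.prems(1) by auto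
  have "- a = sum_list xs" using Cons.prems(2) by (simp add: minus_unique)
  hence "- a \<in> M" using herm_cone_sum_list[OF C xsM] by simp
  hence a0: "a = 0" using herm_cone_antisym[OF C aM] by blast
  thus ?case using Cons a0 xsM by auto
qed simp

text \<open>Finite-set versions of the two preceding facts, via a listing of the set.\<close>
lemma herm_cone_sum:
  assumes C: "herm_cone mul J e M" and "finite F" "\<And>j. j \<in> F \<Longrightarrow> f j \<in> M"
  shows "sum f F \<in> M"
proof -
  obtain xs where "set xs = F" "distinct xs" using finite_distinct_list[OF \<open>finite F\<close>] by blast
  thus ?thesis using herm_cone_sum_list[OF C, of "map f xs"] assms(3) by (auto simp: sum_list_distinct_conv_sum_set)
qed

lemma herm_cone_sum_zero:
  assumes C: "herm_cone mul J e M" and "finite F" "\<And>j. j \<in> F \<Longrightarrow> f j \<in> M"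
    and "sum f F = 0" "j \<in> F"
  shows "f j = 0"
proof -
  obtain xs where "set xs = F" "distinct xs" using finite_distinct_list[OF \<open>finite F\<close>] by blast
  thus ?thesis using herm_cone_sum_list_zero[OF C, of "map f xs"] assms(3-5)
    by (auto simp: sum_list_distinct_conv_sum_set)
qed

text \<open>Easy half of the cone criterion: a cone containing \<open>G\<close> makes \<open>G\<close> anisotropic.\<close>
lemma herm_cone_imp_anisotropic:
  assumes C: "herm_cone mul J e M" and G: "G \<subseteq> M"
  shows "anisotropic mul J G"
  unfolding anisotropic_def nonvanishing_sums_def
proof (intro allI impI ballI)
  let ?q = "\<lambda>(g, x). mul (mul x g) (J x)"
  fix ps p assume ps: "set ps \<subseteq> G \<times> UNIV" and sum0: "sum_list (map ?q ps) = 0" and p: "p \<in> set ps"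
  have "set (map ?q ps) \<subseteq> M" using ps G herm_cone_congruence[OF C] by auto
  thus "?q p = 0" using herm_cone_sum_list_zero[OF C _ sum0] p by auto
qed

section \<open>Rings with involution\<close>

text \<open>An abstract unital ring with involution, with the multiplication passed as a parameter so
  that both \<open>D\<close> and the matrix ring \<open>M\<^sub>n(D)\<close> (with \<open>**\<close>) are instances.\<close>
locale ring_involution =
  fixes mul :: "'r::ab_group_add \<Rightarrow> 'r \<Rightarrow> 'r" and J :: "'r \<Rightarrow> 'r" and one :: 'r
  assumes mul_assoc: "mul a (mul b c) = mul (mul a b) c"
    and mul_add_right: "mul a (b + c) = mul a b + mul a c"
    and mul_add_left: "mul (a + b) c = mul a c + mul b c"
    and one_left: "mul one a = a" and one_right: "mul a one = a"
    and J_add: "J (a + b) = J a + J b"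
    and J_mul: "J (mul a b) = mul (J b) (J a)"
    and J_J: "J (J a) = a"
begin

text \<open>Basic ring laws derived from the locale axioms.\<close>
lemma mul_zero_right: "mul a 0 = 0"
  using mul_add_right[of a 0 0] by simp

lemma mul_zero_left: "mul 0 a = 0"
  using mul_add_left[of 0 0 a] by simp

lemma J_zero: "J 0 = 0"
  using J_add[of 0 0] by simp

lemma J_one: "J one = one"
proof -
  have "one = J (mul one (J one))" by (simp add: one_left J_J)
  also have "\<dots> = J one" using J_mul[of one "J one"] by (simp add: J_J one_left)
  finally show ?thesis by simp
qed

text \<open>Formal reality means anisotropy of the unit.\<close>
lemma formally_real_iff_anisotropic: "formally_real mul J \<longleftrightarrow> anisotropic mul J {one}"
  by (simp add: formally_real_iff_nonvanishing anisotropic_singleton one_right)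

text \<open>Anisotropy of a single element is preserved by congruence \<open>c \<mapsto> q c q\<^sup>J\<close>, hence is a
  congruence invariant when \<open>q\<close> has a left inverse.\<close>
lemma anisotropic_congruence:
  assumes "anisotropic mul J {c}"
  shows "anisotropic mul J {mul (mul q c) (J q)}"
  using assms unfolding anisotropic_singleton
  by (rule nonvanishing_sums_pullback[where h = "\<lambda>x. mul x q" and K = id])
     (simp_all add: J_mul mul_assoc)

lemma anisotropic_congruence_iff:
  assumes "mul q' q = one"
  shows "anisotropic mul J {mul (mul q c) (J q)} \<longleftrightarrow> anisotropic mul J {c}"
proof
  assume "anisotropic mul J {mul (mul q c) (J q)}"
  hence "anisotropic mul J {mul (mul q' (mul (mul q c) (J q))) (J q')}"
    by (rule anisotropic_congruence)
  also have "mul (mul q' (mul (mul q c) (J q))) (J q') = mul (mul (mul q' q) c) (J (mul q' q))"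
    by (simp add: J_mul mul_assoc)
  also have "\<dots> = c" using assms by (simp add: J_one one_left one_right)
  finally show "anisotropic mul J {c}" .
qed (rule anisotropic_congruence)

text \<open>Congruence preserves \<open>e\<close>-hermitian elements when \<open>e\<close> is central.\<close>
lemma herm_set_congruence:
  assumes central: "\<And>a. mul e a = mul a e" and b: "b \<in> herm_set mul J e"
  shows "mul (mul q b) (J q) \<in> herm_set mul J e"
proof -
  have "mul e (J (mul (mul q b) (J q))) = mul (mul (mul e q) (J b)) (J q)"
    by (simp add: J_mul J_J mul_assoc)
  also have "\<dots> = mul (mul q (mul e (J b))) (J q)"
    by (simp only: central[of q] mul_assoc)
  finally have "mul e (J (mul (mul q b) (J q))) = mul (mul q (mul e (J b))) (J q)" .
  thus ?thesis using b unfolding herm_set_def by simp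
qed

text \<open>The cone generated by \<open>G\<close>: all finite sums of terms \<open>x g x\<^sup>J\<close> with \<open>g \<in> G\<close>.\<close>
definition generated_cone :: "'r set \<Rightarrow> 'r set" where
  "generated_cone G =
     {sum_list (map (\<lambda>(g, x). mul (mul x g) (J x)) ps) | ps. set ps \<subseteq> G \<times> UNIV}"

text \<open>The generated cone consists of \<open>e\<close>-hermitian elements, is closed under addition and
  congruence, and contains \<open>G\<close> (take \<open>x = 1\<close>).\<close>
lemma generated_cone_hermitian:
  assumes central: "\<And>a. mul e a = mul a e" and G: "G \<subseteq> herm_set mul J e"
  shows "generated_cone G \<subseteq> herm_set mul J e"
proof -
  have "sum_list (map (\<lambda>(g, x). mul (mul x g) (J x)) ps) \<in> herm_set mul J e"
    if "set ps \<subseteq> G \<times> UNIV" for ps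
    using that
  proof (induction ps)
    case Nil thus ?case by (simp add: herm_set_def J_zero mul_zero_right)
  next
    case (Cons p ps)
    have "(\<lambda>(g, x). mul (mul x g) (J x)) p \<in> herm_set mul J e"
      using Cons.prems G herm_set_congruence[OF central] by (auto split: prod.splits)
    thus ?case using Cons by (simp add: herm_set_def J_add mul_add_right)
  qed
  thus ?thesis unfolding generated_cone_def by blast
qed

lemma generated_cone_add:
  "x \<in> generated_cone G \<Longrightarrow> y \<in> generated_cone G \<Longrightarrow> x + y \<in> generated_cone G"
proof -
  let ?q = "\<lambda>(g, x). mul (mul x g) (J x)"
  assume "x \<in> generated_cone G" "y \<in> generated_cone G"
  then obtain ps qs where "x = sum_list (map ?q ps)" "set ps \<subseteq> G \<times> UNIV"
    and "y = sum_list (map ?q qs)" "set qs \<subseteq> G \<times> UNIV"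
    unfolding generated_cone_def by blast
  hence "x + y = sum_list (map ?q (ps @ qs))" "set (ps @ qs) \<subseteq> G \<times> UNIV" by auto
  thus "x + y \<in> generated_cone G" unfolding generated_cone_def by blast
qed

lemma generated_cone_congruence:
  assumes "m \<in> generated_cone G"
  shows "mul (mul a m) (J a) \<in> generated_cone G"
proof -
  let ?q = "\<lambda>(g, x). mul (mul x g) (J x)"
  obtain ps where m: "m = sum_list (map ?q ps)" and ps: "set ps \<subseteq> G \<times> UNIV"
    using assms unfolding generated_cone_def by blast
  let ?ps' = "map (\<lambda>(g, x). (g, mul a x)) ps"
  have "mul (mul a (sum_list (map ?q ps))) (J a) = sum_list (map ?q ?ps')"
    by (induction ps) (auto simp: mul_zero_left mul_zero_right mul_add_left mul_add_right J_mul mul_assoc)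
  moreover have "set ?ps' \<subseteq> G \<times> UNIV" using ps by auto
  ultimately show ?thesis unfolding generated_cone_def m by blast
qed

text \<open>Anisotropy of \<open>G\<close> is what makes the generated cone pointed.\<close>
lemma generated_cone_pointed:
  assumes "anisotropic mul J G"
  shows "generated_cone G \<inter> uminus ` generated_cone G = {0}"
proof -
  let ?q = "\<lambda>(g, x). mul (mul x g) (J x)"
  have zero: "0 \<in> generated_cone G"
    unfolding generated_cone_def by (rule CollectI, rule exI[of _ "[]"]) simp
  have "x = 0" if x: "x \<in> generated_cone G" and minus_x: "x \<in> uminus ` generated_cone G" for x
  proof -
    obtain ps where ps: "x = sum_list (map ?q ps)" "set ps \<subseteq> G \<times> UNIV"
      using x unfolding generated_cone_def by blast
    obtain y where "y \<in> generated_cone G" and "x = - y" using minus_x by (rule imageE)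
    then obtain qs where qs: "- x = sum_list (map ?q qs)" "set qs \<subseteq> G \<times> UNIV"
      unfolding generated_cone_def by auto
    have "sum_list (map ?q (ps @ qs)) = x + - x" using ps qs by simp
    hence "sum_list (map ?q (ps @ qs)) = 0" by simp
    moreover have "set (ps @ qs) \<subseteq> G \<times> UNIV" using ps qs by auto
    ultimately have "\<forall>p\<in>set (ps @ qs). ?q p = 0"
      using assms unfolding anisotropic_def nonvanishing_sums_def by blast
    hence "\<forall>p\<in>set ps. ?q p = 0" by simp
    thus "x = 0" unfolding ps(1) by (induction ps) auto
  qed
  moreover have "0 \<in> uminus ` generated_cone G" using zero by (metis image_eqI minus_zero)
  ultimately show ?thesis using zero by auto
qed

lemma generated_cone_superset:
  "G \<subseteq> generated_cone G"
proof
  fix g assume "g \<in> G"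
  hence "set [(g, one)] \<subseteq> G \<times> UNIV" and "g = sum_list (map (\<lambda>(g, x). mul (mul x g) (J x)) [(g, one)])"
    by (simp_all add: one_left J_one one_right)
  thus "g \<in> generated_cone G" unfolding generated_cone_def by blast
qed

text \<open>Cone criterion: a set of \<open>e\<close>-hermitian elements (\<open>e\<close> central) lies in an \<open>e\<close>-hermitian
  cone iff it is anisotropic.\<close>
theorem cone_iff_anisotropic:
  assumes central: "\<And>a. mul e a = mul a e" and G: "G \<subseteq> herm_set mul J e"
  shows "(\<exists>M. herm_cone mul J e M \<and> G \<subseteq> M) \<longleftrightarrow> anisotropic mul J G"
proof
  assume "anisotropic mul J G"
  hence "herm_cone mul J e (generated_cone G)"
    unfolding herm_cone_def
    by (intro conjI ballI allI generated_cone_hermitian[OF central G] generated_cone_add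
        generated_cone_congruence generated_cone_pointed)
  thus "\<exists>M. herm_cone mul J e M \<and> G \<subseteq> M" using generated_cone_superset by blast
qed (auto intro: herm_cone_imp_anisotropic)

end

section \<open>Involutions and the conjugate transpose\<close>

context
  fixes s :: "'a::ring_1 \<Rightarrow> 'a"
  assumes inv: "is_involution s"
begin

text \<open>Basic laws of an involution on a unital ring.\<close>
lemma s_add: "s (x + y) = s x + s y"
  using inv unfolding is_involution_def by blast

lemma s_mult: "s (x * y) = s y * s x"
  using inv unfolding is_involution_def by blast

lemma s_s [simp]: "s (s x) = x"
  using inv unfolding is_involution_def by blast

lemma s_0 [simp]: "s 0 = 0"
  using s_add[of 0 0] by simp

lemma s_1 [simp]: "s 1 = 1"
  using s_mult[of 1 "s 1"] by simp

lemma s_eq_0_iff [simp]: "s x = 0 \<longleftrightarrow> x = 0"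
  by (metis s_0 s_s)

lemma s_sum: "s (sum f F) = (\<Sum>i\<in>F. s (f i))"
  by (induction F rule: infinite_finite_induct) (auto simp: s_add)

text \<open>The involution maps the center to itself.\<close>
lemma s_center:
  assumes "c \<in> center" shows "s c \<in> center"
  unfolding center_def
proof (intro CollectI allI)
  fix x
  have "s x * c = c * s x" using assms unfolding center_def by simp
  hence "s (s x * c) = s (c * s x)" by simp
  thus "s c * x = x * s c" by (simp add: s_mult)
qed

text \<open>A ring with involution is an instance of the abstract locale.\<close>
lemma ring_involution_scalar: "ring_involution (*) s 1"
  by unfold_locales (simp_all add: algebra_simps s_add s_mult)

text \<open>The conjugate transpose \<open>[x\<^sub>i\<^sub>j]\<^sup>* = [x\<^sub>j\<^sub>i\<^sup>*]\<close> is an involution of the matrix ring.\<close>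
lemma mstar_entry [simp]: "mstar s X $ i $ j = s (X $ j $ i)"
  by (simp add: mstar_def)

lemma mstar_mult: "mstar s (X ** Y) = mstar s Y ** mstar s X"
  by (simp add: vec_eq_iff matrix_matrix_mult_def s_sum s_mult)

lemma mstar_mstar [simp]: "mstar s (mstar s X) = X"
  by (simp add: vec_eq_iff)

lemma mstar_add: "mstar s (X + Y) = mstar s X + mstar s Y"
  by (simp add: vec_eq_iff s_add)

lemma mstar_mat: "mstar s (mat c) = mat (s c)"
  by (simp add: vec_eq_iff mat_def)

text \<open>Conjugate transposition preserves invertibility.\<close>
lemma mstar_invertible: "invertible P \<Longrightarrow> invertible (mstar s P)"
  unfolding invertible_def by (metis mstar_mult mstar_mat s_1)

end

section \<open>Matrix algebra over a noncommutative ring\<close>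

text \<open>Multiplying by a scalar matrix scales entries on the left or right.\<close>
lemma mat_mult_entry: "(mat c ** X) $ i $ j = c * X $ i $ j"
  by (simp add: matrix_matrix_mult_def mat_def if_distrib if_distribR sum.delta cong: if_cong)

lemma mult_mat_entry: "(X ** mat c) $ i $ j = X $ i $ j * c"
  by (simp add: matrix_matrix_mult_def mat_def if_distrib if_distribR sum.delta' cong: if_cong)

text \<open>Scalar matrices of central elements are central.\<close>
lemma mat_central: "(c::'a::ring_1) \<in> center \<Longrightarrow> mat c ** X = X ** mat c"
  by (simp add: vec_eq_iff mat_mult_entry mult_mat_entry center_def)

text \<open>Further bookkeeping: products of scalar matrices, right distributivity, entries of
  sums, and the two-sided inverse \<open>matrix_inv\<close>.\<close>
lemma mat_mult_mat: "mat a ** mat (b::'a::semiring_1) = mat (a * b)"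
  by (simp add: vec_eq_iff mat_mult_entry) (simp add: mat_def)

lemma matrix_add_rdistrib: "(B + C) ** (A::'a::semiring_1^'n^'m) = B ** A + C ** A"
  by (vector matrix_matrix_mult_def sum.distrib[symmetric] field_simps)

lemma sum_list_entry: "sum_list xs $ i = sum_list (map (\<lambda>x. x $ i) xs)"
  by (induction xs) auto

lemma matrix_inv_right: "invertible P \<Longrightarrow> P ** matrix_inv P = mat 1"
  and matrix_inv_left: "invertible P \<Longrightarrow> matrix_inv P ** P = mat 1"
  unfolding invertible_def matrix_inv_def by (metis (mono_tags, lifting) someI)+

text \<open>Matrices with the conjugate transpose form a ring with involution.\<close>
lemma ring_involution_mstar:
  fixes s :: "'a::ring_1 \<Rightarrow> 'a"
  assumes inv: "is_involution s"
  shows "ring_involution (**) (mstar s) (mat 1 :: 'a^'n::finite^'n)"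
  by unfold_locales
    (simp_all add: matrix_mul_assoc matrix_add_ldistrib matrix_add_rdistrib
      mstar_add[OF inv] mstar_mult[OF inv] mstar_mstar[OF inv])

section \<open>The involution \<open>X\<^sup># = A\<^sup>-\<^sup>1 X\<^sup>* A\<close>\<close>

locale hermitian_form =
  fixes s :: "'d::division_ring \<Rightarrow> 'd" and \<eta> :: 'd and A :: "'d^'n::finite^'n"
  assumes inv: "is_involution s"
    and eta_central: "\<eta> \<in> center"
    and eta_unit: "\<eta> * s \<eta> = 1"
    and A_invertible: "invertible A"
    and A_hermitian: "mat \<eta> ** mstar s A = A"
begin

lemmas [simp] = mstar_entry[OF inv] mstar_mstar[OF inv] s_s[OF inv] s_0[OF inv] s_1[OF inv]

text \<open>The involution \<open>#\<close> of the theorem, \<open>X\<^sup># = A\<^sup>-\<^sup>1 X\<^sup>* A\<close>.\<close>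
abbreviation Ai :: "'d^'n^'n" where "Ai \<equiv> matrix_inv A"

definition sharp :: "'d^'n^'n \<Rightarrow> 'd^'n^'n" where
  "sharp X = Ai ** mstar s X ** A"

text \<open>Inverse and scalar identities for \<open>A\<close> and \<open>\<eta>\<close>; note \<open>A\<^sup>* = \<eta>\<^sup>* A\<close> and
  \<open>(A\<^sup>-\<^sup>1)\<^sup>* = A\<^sup>-\<^sup>1 \<eta>\<close>.\<close>
lemma A_Ai: "A ** Ai = mat 1" and Ai_A: "Ai ** A = mat 1"
  using matrix_inv_right[OF A_invertible] matrix_inv_left[OF A_invertible] .

lemma mult_A_Ai [simp]: "X ** A ** Ai = X"
  by (metis A_Ai matrix_mul_assoc matrix_mul_rid)

lemma mult_Ai_A [simp]: "X ** Ai ** A = X"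
  by (metis Ai_A matrix_mul_assoc matrix_mul_rid)

lemma s_eta_central: "s \<eta> \<in> center"
  using s_center[OF inv eta_central] .

lemma s_eta_unit: "s \<eta> * \<eta> = 1"
  using eta_unit eta_central by (simp add: center_def)

lemma mat_eta_central: "mat \<eta> ** X = X ** mat \<eta>"
  by (rule mat_central[OF eta_central])

lemma mat_s_eta_central: "mat (s \<eta>) ** X = X ** mat (s \<eta>)"
  by (rule mat_central[OF s_eta_central])

lemma mstar_A: "mstar s A = mat (s \<eta>) ** A"
proof -
  have "mat (s \<eta>) ** A = mat (s \<eta>) ** (mat \<eta> ** mstar s A)" using A_hermitian by simp
  also have "\<dots> = mstar s A" by (simp add: matrix_mul_assoc mat_mult_mat s_eta_unit)
  finally show ?thesis by simp
qed

lemma mstar_Ai: "mstar s Ai = Ai ** mat \<eta>"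
proof -
  have inv_star: "mstar s Ai ** mstar s A = mat 1"
    using mstar_mult[OF inv, of A Ai] A_Ai by (simp add: mstar_mat[OF inv])
  have "Ai ** mat \<eta> = mstar s Ai ** mstar s A ** Ai ** mat \<eta>" using inv_star by simp
  also have "\<dots> = mstar s Ai ** (mat (s \<eta>) ** mat \<eta>)"
    by (simp add: mstar_A matrix_mul_assoc)
  also have "\<dots> = mstar s Ai" by (simp add: mat_mult_mat s_eta_unit)
  finally show ?thesis by simp
qed

text \<open>The hypothesis on \<open>A\<close> says that \<open>A\<close> is \<open>\<eta>\<close>-hermitian.\<close>
lemma A_hermitian_set: "A \<in> herm_set (**) (mstar s) (mat \<eta>)"
  using A_hermitian unfolding herm_set_def by simp

text \<open>Conjugating a central scalar matrix by \<open>A\<close> does nothing; this makes \<open>#\<close> an involution.\<close>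
lemma conjugate_scalar: "c \<in> center \<Longrightarrow> Ai ** mat c ** A = mat c"
  by (simp add: mat_central[symmetric] matrix_mul_assoc[symmetric] Ai_A)

lemma sharp_sharp: "sharp (sharp X) = X"
proof -
  have "sharp (sharp X) = (Ai ** mat (s \<eta>) ** A) ** X ** (Ai ** mat \<eta> ** A)"
    unfolding sharp_def by (simp add: mstar_mult[OF inv] mstar_A mstar_Ai matrix_mul_assoc)
  also have "\<dots> = mat (s \<eta>) ** X ** mat \<eta>"
    by (simp add: conjugate_scalar eta_central s_eta_central)
  also have "\<dots> = X"
    by (simp add: mat_eta_central[symmetric] matrix_mul_assoc mat_mult_mat eta_unit)
  finally show ?thesis .
qed

text \<open>Hence \<open>#\<close> is an involution of the matrix ring.\<close>
lemma ring_involution_sharp: "ring_involution (**) sharp (mat 1)"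
proof
  show "sharp (sharp X) = X" for X by (rule sharp_sharp)
qed (simp_all add: sharp_def matrix_mul_assoc matrix_add_ldistrib matrix_add_rdistrib
       mstar_add[OF inv] mstar_mult[OF inv])

text \<open>The substitution \<open>X = Y A\<close> turns \<open>X X\<^sup>#\<close> into \<open>\<eta>\<^sup>* (Y A Y\<^sup>*) A\<close>, so \<open>{1}\<close> is anisotropic
  for \<open>#\<close> iff \<open>{A}\<close> is anisotropic for \<open>*\<close>.\<close>
lemma sharp_square: "(Y ** A) ** sharp (Y ** A) = mat (s \<eta>) ** (Y ** A ** mstar s Y) ** A"
proof -
  have "(Y ** A) ** sharp (Y ** A) = Y ** (A ** Ai) ** mstar s A ** mstar s Y ** A"
    unfolding sharp_def by (simp add: mstar_mult[OF inv] matrix_mul_assoc)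
  also have "\<dots> = Y ** mat (s \<eta>) ** A ** mstar s Y ** A"
    by (simp add: A_Ai mstar_A matrix_mul_assoc)
  also have "\<dots> = mat (s \<eta>) ** (Y ** A ** mstar s Y) ** A"
    by (simp only: mat_s_eta_central[of Y] matrix_mul_assoc)
  finally show ?thesis .
qed

text \<open>The twisting maps \<open>Z \<mapsto> \<eta>\<^sup>* Z A\<close> and \<open>Z \<mapsto> \<eta> Z A\<^sup>-\<^sup>1\<close> are mutually inverse.\<close>
lemma untwist_twist: "mat \<eta> ** (mat (s \<eta>) ** Z ** A) ** Ai = Z"
  by (simp add: matrix_mul_assoc mat_mult_mat eta_unit)

lemma twist_untwist: "mat (s \<eta>) ** (mat \<eta> ** Z ** Ai) ** A = Z"
  by (simp add: matrix_mul_assoc mat_mult_mat s_eta_unit)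

text \<open>Anisotropy of \<open>{1}\<close> for \<open>#\<close> is anisotropy of \<open>{A}\<close> for \<open>*\<close>: both directions transport
  vanishing sums along \<open>X \<mapsto> X A\<^sup>-\<^sup>1\<close> resp. \<open>Y \<mapsto> Y A\<close>.\<close>
lemma sharp_anisotropic_iff:
  "anisotropic (**) sharp {mat 1} \<longleftrightarrow> anisotropic (**) (mstar s) {A}"
  unfolding anisotropic_singleton matrix_mul_rid
proof
  assume "nonvanishing_sums UNIV (\<lambda>X. X ** sharp X)"
  thus "nonvanishing_sums UNIV (\<lambda>Y. Y ** A ** mstar s Y)"
  proof (rule nonvanishing_sums_pullback[where h = "\<lambda>Y. Y ** A" and K = "\<lambda>Z. mat (s \<eta>) ** Z ** A"])
    show "mat (s \<eta>) ** Z ** A = 0 \<Longrightarrow> Z = 0" for Z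
      by (metis untwist_twist times0_left times0_right)
  qed (simp_all add: sharp_square matrix_add_ldistrib matrix_add_rdistrib)
next
  assume "nonvanishing_sums UNIV (\<lambda>Y. Y ** A ** mstar s Y)"
  thus "nonvanishing_sums UNIV (\<lambda>X. X ** sharp X)"
  proof (rule nonvanishing_sums_pullback[where h = "\<lambda>X. X ** Ai" and K = "\<lambda>Z. mat \<eta> ** Z ** Ai"])
    show "X ** Ai ** A ** mstar s (X ** Ai) = mat \<eta> ** (X ** sharp X) ** Ai" for X
      using sharp_square[of "X ** Ai"] untwist_twist[of "X ** mstar s (X ** Ai)"] by simp
    show "mat \<eta> ** Z ** Ai = 0 \<Longrightarrow> Z = 0" for Z
      by (metis twist_untwist times0_left times0_right)
  qed (simp_all add: matrix_add_ldistrib matrix_add_rdistrib)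
qed

end

section \<open>Diagonalising hermitian matrices\<close>

text \<open>Elementary matrix \<open>I + e\<^sub>i r\<close>: right multiplication adds \<open>r\<^sub>b\<close> times column \<open>i\<close> to
  column \<open>b\<close>.\<close>
definition transvection :: "'n::finite \<Rightarrow> 'd::ring_1^'n \<Rightarrow> 'd^'n^'n" where
  "transvection i r = (\<chi> a b. (if a = b then 1 else 0) + (if a = i then r $ b else 0))"

lemma transvection_entry:
  "transvection i r $ a $ b = (if a = b then 1 else 0) + (if a = i then r $ b else 0)"
  by (simp add: transvection_def)

text \<open>Rewriting products with conditional zeros, for the entry computations below.\<close>
lemma mult_if_zero:
  "(x::'a::semiring_1) * (if P then y else 0) = (if P then x * y else 0)"
  "(if P then y else 0) * (x::'a::semiring_1) = (if P then y * x else 0)"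
  by auto

lemma mult_transvection_entry: "(X ** transvection i r) $ a $ b = X $ a $ b + X $ a $ i * r $ b"
  by (simp add: matrix_matrix_mult_def transvection_entry distrib_left sum.distrib mult_if_zero
      sum.delta sum.delta')

text \<open>Transvections with \<open>r\<^sub>i = 0\<close> compose additively, hence are invertible.\<close>
lemma transvection_mult_transvection:
  assumes "r $ i = 0"
  shows "transvection i r ** transvection i r' = transvection i (r + r')"
  using assms by (simp add: vec_eq_iff mult_transvection_entry) (simp add: transvection_entry)

lemma transvection_invertible:
  assumes "r $ i = 0"
  shows "invertible (transvection i r)"
  unfolding invertible_def
proof (intro exI conjI)
  have one: "transvection i 0 = mat 1" by (simp add: vec_eq_iff transvection_entry mat_def)
  show "transvection i r ** transvection i (- r) = mat 1"
    using transvection_mult_transvection[OF assms, of "- r"] one by simp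
  show "transvection i (- r) ** transvection i r = mat 1"
    using transvection_mult_transvection[of "- r" i r] assms one by simp
qed

text \<open>The identity matrix is invertible (the trivial congruence).\<close>
lemma invertible_mat_1: "invertible (mat 1 :: 'a::semiring_1^'n^'n)"
  unfolding invertible_def by auto

context
  fixes s :: "'d::division_ring \<Rightarrow> 'd" and \<eta> :: 'd
  assumes inv: "is_involution s" and eta_central: "\<eta> \<in> center"
begin

lemmas [simp] = mstar_entry[OF inv] s_s[OF inv] s_0[OF inv] s_1[OF inv] s_eq_0_iff[OF inv]

text \<open>Effect of the congruence \<open>B \<mapsto> T\<^sup>* B T\<close> by a transvection, entrywise.\<close>
lemma transvection_congruence_entry:
  "(mstar s (transvection i r) ** B ** transvection i r) $ a $ b
     = B $ a $ b + s (r $ a) * B $ i $ b + (B $ a $ i + s (r $ a) * B $ i $ i) * r $ b"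
proof -
  have "s (transvection i r $ k $ a) = (if k = a then 1 else 0) + (if k = i then s (r $ a) else 0)" for k
    by (simp add: transvection_entry s_add[OF inv])
  hence "(mstar s (transvection i r) ** B) $ a $ l = B $ a $ l + s (r $ a) * B $ i $ l" for l
    by (simp add: matrix_matrix_mult_def distrib_right sum.distrib mult_if_zero sum.delta sum.delta')
  thus ?thesis by (simp add: mult_transvection_entry)
qed

text \<open>Entries of an \<open>\<eta>\<close>-hermitian matrix satisfy \<open>B\<^sub>a\<^sub>b = \<eta> B\<^sub>b\<^sub>a\<^sup>*\<close>, and congruence preserves
  hermitian matrices.\<close>
lemma hermitian_entry:
  "B \<in> herm_set (**) (mstar s) (mat \<eta>) \<Longrightarrow> B $ a $ b = \<eta> * s (B $ b $ a)"
proof -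
  assume "B \<in> herm_set (**) (mstar s) (mat \<eta>)"
  hence "(mat \<eta> ** mstar s B) $ a $ b = B $ a $ b" by (simp add: herm_set_def)
  thus ?thesis by (simp add: mat_mult_entry)
qed

lemma hermitian_congruence:
  "B \<in> herm_set (**) (mstar s) (mat \<eta>) \<Longrightarrow> mstar s P ** B ** P \<in> herm_set (**) (mstar s) (mat \<eta>)"
  using ring_involution.herm_set_congruence[OF ring_involution_mstar[OF inv], of "mat \<eta>" B "mstar s P"]
  by (simp add: mat_central[OF eta_central] mstar_mstar[OF inv])

text \<open>Successive congruences compose.\<close>
lemma congruence_compose:
  "mstar s (Q1 ** Q2) ** B ** (Q1 ** Q2) = mstar s Q2 ** (mstar s Q1 ** B ** Q1) ** Q2"
  by (simp add: mstar_mult[OF inv] matrix_mul_assoc)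

text \<open>\<open>rows_diagonal S B\<close>: the rows of \<open>B\<close> indexed by \<open>S\<close> vanish off the diagonal; for hermitian
  \<open>B\<close> so do the corresponding columns.\<close>
definition rows_diagonal :: "'n::finite set \<Rightarrow> 'd^'n^'n \<Rightarrow> bool" where
  "rows_diagonal S B \<longleftrightarrow> (\<forall>a\<in>S. \<forall>b. b \<noteq> a \<longrightarrow> B $ a $ b = 0)"

lemma rows_diagonal_column:
  "B \<in> herm_set (**) (mstar s) (mat \<eta>) \<Longrightarrow> rows_diagonal S B \<Longrightarrow> a \<in> S \<Longrightarrow> b \<noteq> a \<Longrightarrow> B $ b $ a = 0"
  unfolding rows_diagonal_def using hermitian_entry[of B b a] by simp

text \<open>Symmetric Gaussian elimination: a nonzero pivot \<open>B\<^sub>i\<^sub>i\<close> clears row and column \<open>i\<close>.\<close>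
lemma clear_pivot:
  fixes B :: "'d^'n::finite^'n"
  assumes herm: "B \<in> herm_set (**) (mstar s) (mat \<eta>)" and S: "rows_diagonal S B"
    and i: "i \<notin> S" and pivot: "B $ i $ i \<noteq> 0"
  shows "\<exists>Q. invertible Q \<and> rows_diagonal (insert i S) (mstar s Q ** B ** Q)"
proof -
  define r :: "'d^'n" where
    "r = (\<chi> b. if b \<noteq> i \<and> b \<notin> S then - (inverse (B $ i $ i) * B $ i $ b) else 0)"
  have ri: "r $ i = 0" and rS: "a \<in> S \<Longrightarrow> r $ a = 0" for a by (simp_all add: r_def)
  have "(mstar s (transvection i r) ** B ** transvection i r) $ a $ b = 0"
    if a: "a \<in> insert i S" and ba: "b \<noteq> a" for a b
  proof (cases "a = i")
    case True
    show ?thesis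
    proof (cases "b \<in> S")
      case True
      have "B $ i $ b = 0" using rows_diagonal_column[OF herm S True] ba \<open>a = i\<close> by simp
      thus ?thesis using \<open>a = i\<close> True by (simp add: transvection_congruence_entry ri rS)
    next
      case False
      have "B $ i $ i * (inverse (B $ i $ i) * B $ i $ b) = B $ i $ b"
        using pivot by (simp add: mult.assoc[symmetric])
      thus ?thesis using \<open>a = i\<close> False ba by (simp add: transvection_congruence_entry ri r_def)
    qed
  next
    case False
    hence aS: "a \<in> S" using a by simp
    have "B $ a $ b = 0" "B $ a $ i = 0" using S aS ba False unfolding rows_diagonal_def by auto
    thus ?thesis by (simp add: transvection_congruence_entry rS[OF aS])
  qed
  thus ?thesis using transvection_invertible[OF ri] unfolding rows_diagonal_def by blast
qed

text \<open>This is where the hypothesis is used: unless \<open>\<eta> = -1\<close> and \<open>* = id\<close>, not every element is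
  \<open>\<eta>\<close>-skew.\<close>
lemma exists_not_skew:
  assumes "\<eta> \<noteq> -1 \<or> s \<noteq> id"
  shows "\<exists>t. t + \<eta> * s t \<noteq> 0"
proof (rule ccontr)
  assume "\<not> ?thesis"
  hence skew: "t + \<eta> * s t = 0" for t by blast
  have eta: "\<eta> = -1" using skew[of 1] by (simp add: add_eq_0_iff)
  have "s t = t" for t using skew[of t] eta by simp
  hence "s = id" by auto
  thus False using assms eta by simp
qed

text \<open>If \<open>B\<^sub>p\<^sub>q \<noteq> 0\<close> but \<open>B\<^sub>p\<^sub>p = B\<^sub>q\<^sub>q = 0\<close>, adding a multiple of row \<open>p\<close> to row \<open>q\<close> (congruently)
  produces a nonzero pivot at \<open>p\<close>.\<close>
lemma create_pivot:
  fixes B :: "'d^'n::finite^'n"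
  assumes cond: "\<eta> \<noteq> -1 \<or> s \<noteq> id"
    and herm: "B \<in> herm_set (**) (mstar s) (mat \<eta>)" and S: "rows_diagonal S B"
    and p: "p \<notin> S" and q: "q \<notin> S" and pq: "p \<noteq> q"
    and Bpq: "B $ p $ q \<noteq> 0" and Bpp: "B $ p $ p = 0" and Bqq: "B $ q $ q = 0"
  shows "\<exists>Q. invertible Q \<and> rows_diagonal S (mstar s Q ** B ** Q) \<and> (mstar s Q ** B ** Q) $ p $ p \<noteq> 0"
proof -
  obtain t where t: "t + \<eta> * s t \<noteq> 0" using exists_not_skew[OF cond] by blast
  define l where "l = inverse (B $ p $ q) * t"
  define r :: "'d^'n" where "r = (\<chi> b. if b = p then l else 0)"
  have rq: "r $ q = 0" and rS: "a \<in> S \<Longrightarrow> r $ a = 0" for a using pq p by (auto simp: r_def)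
  have Bpq_l: "B $ p $ q * l = t" using Bpq by (simp add: l_def mult.assoc[symmetric])
  have "s l * B $ q $ p = s l * (\<eta> * s (B $ p $ q))" using hermitian_entry[OF herm, of q p] by simp
  also have "\<dots> = \<eta> * (s l * s (B $ p $ q))"
  proof -
    have "\<eta> * s l = s l * \<eta>" using eta_central by (simp add: center_def)
    thus ?thesis by (simp only: mult.assoc[symmetric])
  qed
  also have "\<dots> = \<eta> * s t" by (simp add: s_mult[OF inv, symmetric] Bpq_l)
  finally have "s l * B $ q $ p = \<eta> * s t" .
  with Bpq_l have pivot: "(mstar s (transvection q r) ** B ** transvection q r) $ p $ p \<noteq> 0"
    using t pq by (simp add: transvection_congruence_entry r_def Bpp Bqq add.commute)
  have "rows_diagonal S (mstar s (transvection q r) ** B ** transvection q r)"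
    unfolding rows_diagonal_def
  proof (intro ballI allI impI)
    fix a b assume aS: "a \<in> S" and ba: "b \<noteq> a"
    have "B $ a $ b = 0" "B $ a $ q = 0" using S aS ba q unfolding rows_diagonal_def by auto
    thus "(mstar s (transvection q r) ** B ** transvection q r) $ a $ b = 0"
      by (simp add: transvection_congruence_entry rS[OF aS])
  qed
  thus ?thesis using pivot transvection_invertible[OF rq] by blast
qed

text \<open>One elimination step: a nonzero off-diagonal entry allows to clear one more row.\<close>
lemma elimination_step:
  fixes B :: "'d^'n::finite^'n"
  assumes cond: "\<eta> \<noteq> -1 \<or> s \<noteq> id"
    and herm: "B \<in> herm_set (**) (mstar s) (mat \<eta>)" and S: "rows_diagonal S B"
    and pq: "p \<noteq> q" "B $ p $ q \<noteq> 0"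
  shows "\<exists>Q i. invertible Q \<and> i \<notin> S \<and> rows_diagonal (insert i S) (mstar s Q ** B ** Q)"
proof -
  have pS: "p \<notin> S" using S pq unfolding rows_diagonal_def by auto
  have qS: "q \<notin> S" using rows_diagonal_column[OF herm S, of q p] pq by blast
  consider "B $ p $ p \<noteq> 0" | "B $ q $ q \<noteq> 0" | "B $ p $ p = 0" "B $ q $ q = 0" by blast
  thus ?thesis
  proof cases
    case 1 thus ?thesis using clear_pivot[OF herm S pS] pS by blast
  next
    case 2 thus ?thesis using clear_pivot[OF herm S qS] qS by blast
  next
    case 3
    obtain Q1 where Q1: "invertible Q1" "rows_diagonal S (mstar s Q1 ** B ** Q1)"
        "(mstar s Q1 ** B ** Q1) $ p $ p \<noteq> 0"
      using create_pivot[OF cond herm S pS qS pq 3] by blast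
    obtain Q2 where Q2: "invertible Q2"
        "rows_diagonal (insert p S) (mstar s Q2 ** (mstar s Q1 ** B ** Q1) ** Q2)"
      using clear_pivot[OF hermitian_congruence[OF herm] Q1(2) pS Q1(3)] by blast
    show ?thesis
      using invertible_mult[OF Q1(1) Q2(1)] Q2(2) pS unfolding congruence_compose[symmetric] by blast
  qed
qed

text \<open>A matrix without nonzero off-diagonal entries is diagonal.\<close>
lemma diagonal_matrix:
  "(\<And>p q. p \<noteq> q \<Longrightarrow> B $ p $ q = 0) \<Longrightarrow> B = diag_mat (\<lambda>i. B $ i $ i)"
  by (auto simp: vec_eq_iff diag_mat_def)

text \<open>Every \<open>\<eta>\<close>-hermitian matrix is congruent to a diagonal one (induction on the number of
  rows not yet cleared).\<close>
theorem hermitian_diagonalisation: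
  fixes B :: "'d^'n::finite^'n"
  assumes cond: "\<eta> \<noteq> -1 \<or> s \<noteq> id" and herm: "B \<in> herm_set (**) (mstar s) (mat \<eta>)"
  shows "\<exists>P d. invertible P \<and> mstar s P ** B ** P = diag_mat d"
proof -
  have partial: "\<exists>P d. invertible P \<and> mstar s P ** B ** P = diag_mat d"
    if "B \<in> herm_set (**) (mstar s) (mat \<eta>)" "rows_diagonal S B" for S and B :: "'d^'n^'n"
    using that
  proof (induction "card (- S)" arbitrary: B S rule: less_induct)
    case less
    show ?case
    proof (cases "\<exists>p q. p \<noteq> q \<and> B $ p $ q \<noteq> 0")
      case False
      hence "B = diag_mat (\<lambda>i. B $ i $ i)" by (intro diagonal_matrix) blast
      hence "mstar s (mat 1) ** B ** mat 1 = diag_mat (\<lambda>i. B $ i $ i)"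
        by (simp add: mstar_mat[OF inv])
      thus ?thesis using invertible_mat_1 by blast
    next
      case True
      then obtain p q where pq: "p \<noteq> q" "B $ p $ q \<noteq> 0" by blast
      obtain Q i where Q: "invertible Q" "i \<notin> S" "rows_diagonal (insert i S) (mstar s Q ** B ** Q)"
        using elimination_step[OF cond less.prems pq] by blast
      have "- insert i S = - S - {i}" by auto
      moreover have "card (- S - {i}) < card (- S)"
        by (rule card_Diff1_less) (use Q(2) in auto)
      ultimately have "card (- insert i S) < card (- S)" by (simp only:)
      then obtain P d where P: "invertible P" "mstar s P ** (mstar s Q ** B ** Q) ** P = diag_mat d"
        using less.hyps hermitian_congruence[OF less.prems(1)] Q(3) by blast
      show ?thesis
        using invertible_mult[OF Q(1) P(1)] P(2) unfolding congruence_compose[symmetric] by blast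
    qed
  qed
  show ?thesis using partial[of B "{}"] herm by (simp add: rows_diagonal_def)
qed

end

section \<open>Diagonal forms and cones in \<open>D\<close>\<close>

text \<open>The matrix \<open>z E\<^sub>i\<^sub>j\<close>; it embeds \<open>D\<close> into a corner of \<open>M\<^sub>n(D)\<close>.\<close>
definition unit_mat :: "'n::finite \<Rightarrow> 'n \<Rightarrow> 'd::ring_1 \<Rightarrow> 'd^'n^'n" where
  "unit_mat i j z = (\<chi> a b. if a = i \<and> b = j then z else 0)"

lemma unit_mat_add: "unit_mat i j (x + y) = unit_mat i j x + unit_mat i j y"
  by (simp add: vec_eq_iff unit_mat_def)

lemma unit_mat_eq_0: "unit_mat i j z = 0 \<longleftrightarrow> z = 0"
  by (auto simp: vec_eq_iff unit_mat_def)

text \<open>An invertible diagonal matrix has nonzero diagonal entries.\<close>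
lemma diag_invertible_nonzero:
  assumes "invertible (diag_mat d :: 'd::ring_1^'n::finite^'n)"
  shows "d j \<noteq> 0"
proof
  assume d0: "d j = 0"
  obtain B where "diag_mat d ** B = mat 1" using assms unfolding invertible_def by blast
  hence "(diag_mat d ** B) $ j $ j = 1" by (simp add: mat_def)
  moreover have "(diag_mat d ** B) $ j $ j = 0"
    by (simp add: matrix_matrix_mult_def diag_mat_def d0 mult_if_zero sum.delta)
  ultimately show False by simp
qed

context
  fixes s :: "'d::division_ring \<Rightarrow> 'd"
  assumes inv: "is_involution s"
begin

lemmas [simp] = mstar_entry[OF inv] mstar_mstar[OF inv]

text \<open>Entries of \<open>X diag(d) Y\<^sup>*\<close>; in particular \<open>(z E\<^sub>i\<^sub>j) diag(d) (z E\<^sub>i\<^sub>j)\<^sup>* = (z d\<^sub>j z\<^sup>*) E\<^sub>i\<^sub>i\<close>.\<close>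
lemma diag_quadratic_entry:
  "(X ** diag_mat d ** mstar s Y) $ a $ b = (\<Sum>l\<in>UNIV. X $ a $ l * d l * s (Y $ b $ l))"
  by (simp add: matrix_matrix_mult_def diag_mat_def mult_if_zero sum.delta sum.delta')

lemma unit_mat_diag_square:
  "unit_mat i j z ** diag_mat d ** mstar s (unit_mat i j z) = unit_mat i i (z * d j * s z)"
proof -
  have "unit_mat i j z $ a $ l * d l * s (unit_mat i j z $ b $ l) =
      (if l = j then (if a = i \<and> b = i then z * d j * s z else 0) else 0)" for a b l
    by (simp add: unit_mat_def s_0[OF inv])
  thus ?thesis by (simp add: vec_eq_iff diag_quadratic_entry) (simp add: unit_mat_def)
qed

text \<open>Anisotropy is invariant under congruence by invertible matrices.\<close>
lemma anisotropic_matrix_congruence: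
  assumes "invertible P"
  shows "anisotropic (**) (mstar s) {mstar s P ** B ** P} \<longleftrightarrow> anisotropic (**) (mstar s) {B}"
proof -
  have "mstar s (matrix_inv P) ** mstar s P = mat 1"
    using mstar_mult[OF inv, of P "matrix_inv P"] matrix_inv_right[OF assms]
    by (simp add: mstar_mat[OF inv] s_1[OF inv])
  from ring_involution.anisotropic_congruence_iff[OF ring_involution_mstar[OF inv] this]
  show ?thesis by simp
qed

text \<open>Corner embedding: anisotropy of \<open>diag(d)\<close> in \<open>M\<^sub>n(D)\<close> gives anisotropy of the entries
  \<open>d\<^sub>i\<close> in \<open>D\<close>, hence an \<open>\<eta>\<close>-hermitian cone of \<open>D\<close> containing them.\<close>
lemma cone_of_diagonal:
  fixes d :: "'n::finite \<Rightarrow> 'd"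
  assumes eta_central: "\<eta> \<in> center" and aniso: "anisotropic (**) (mstar s) {diag_mat d}"
    and herm: "\<And>j. d j \<in> herm_set (*) s \<eta>"
  shows "\<exists>M. herm_cone (*) s \<eta> M \<and> (\<forall>i. d i \<in> M)"
proof -
  fix i0 :: 'n
  have "anisotropic (*) s (range d)"
    unfolding anisotropic_def using aniso[unfolded anisotropic_singleton]
  proof (rule nonvanishing_sums_pullback
      [where h = "\<lambda>(g, x). unit_mat i0 (inv d g) x" and K = "unit_mat i0 i0"])
    fix y :: "'d \<times> 'd" assume "y \<in> range d \<times> UNIV"
    then obtain g x where y: "y = (g, x)" and g: "g \<in> range d" by blast
    show "(\<lambda>X. X ** diag_mat d ** mstar s X) ((\<lambda>(g, x). unit_mat i0 (inv d g) x) y) =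
        unit_mat i0 i0 ((\<lambda>(g, x). x * g * s x) y)"
      using f_inv_into_f[OF g] by (simp add: y unit_mat_diag_square)
  qed (simp_all add: unit_mat_add unit_mat_eq_0)
  moreover have "\<And>a. \<eta> * a = a * \<eta>" using eta_central by (simp add: center_def)
  ultimately obtain M where "herm_cone (*) s \<eta> M" "range d \<subseteq> M"
    using ring_involution.cone_iff_anisotropic[OF ring_involution_scalar[OF inv], of \<eta> "range d"] herm
    by blast
  thus ?thesis by blast
qed

text \<open>Conversely, if the nonzero entries \<open>d\<^sub>i\<close> lie in a cone of \<open>D\<close>, then each diagonal entry of
  \<open>\<Sum> X\<^sub>k diag(d) X\<^sub>k\<^sup>*\<close> is a sum of cone elements \<open>x d\<^sub>l x\<^sup>*\<close>, so a vanishing sum forces all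
  \<open>X\<^sub>k = 0\<close>.\<close>
lemma diagonal_anisotropic:
  fixes d :: "'n::finite \<Rightarrow> 'd"
  assumes M: "herm_cone (*) s \<eta> M" "\<And>i. d i \<in> M" and nonzero: "\<And>i. d i \<noteq> 0"
  shows "anisotropic (**) (mstar s) {diag_mat d}"
  unfolding anisotropic_singleton nonvanishing_sums_def
proof (intro allI impI ballI)
  fix Xs X
  assume sum0: "sum_list (map (\<lambda>X. X ** diag_mat d ** mstar s X) Xs) = 0" and X: "X \<in> set Xs"
  define v where "v a Y = (\<Sum>l\<in>UNIV. Y $ a $ l * d l * s (Y $ a $ l))" for a and Y :: "'d^'n^'n"
  have term_in: "Y $ a $ l * d l * s (Y $ a $ l) \<in> M" for Y :: "'d^'n^'n" and a l
    using herm_cone_congruence[OF M(1) M(2)] .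
  have v_in: "v a Y \<in> M" for a Y
    unfolding v_def by (rule herm_cone_sum[OF M(1)]) (simp_all add: term_in)
  have "sum_list (map (v a) Xs) = 0" for a
    using arg_cong[OF sum0, of "\<lambda>Z. Z $ a $ a"]
    by (simp add: sum_list_entry diag_quadratic_entry comp_def v_def[abs_def])
  hence vX: "v a X = 0" for a
    using herm_cone_sum_list_zero[OF M(1), of "map (v a) Xs"] v_in X by auto
  have "X $ a $ l * d l * s (X $ a $ l) = 0" for a l
    by (rule herm_cone_sum_zero[OF M(1), where f = "\<lambda>l. X $ a $ l * d l * s (X $ a $ l)" and F = UNIV])
      (use vX[of a] term_in in \<open>simp_all add: v_def\<close>)
  hence "X $ a $ l = 0" for a l using nonzero by (simp add: s_eq_0_iff[OF inv])
  hence "X = 0" by (simp add: vec_eq_iff)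
  thus "X ** diag_mat d ** mstar s X = 0" by simp
qed

end

context hermitian_form
begin

text \<open>Criterion (4): under the hypothesis of the theorem, \<open>{A}\<close> is anisotropic iff some
  diagonalisation of \<open>A\<close> has all its entries in an \<open>\<eta>\<close>-hermitian cone of \<open>D\<close>.\<close>
theorem anisotropic_iff_diagonal_cone:
  assumes cond: "\<eta> \<noteq> -1 \<or> s \<noteq> id"
  shows "anisotropic (**) (mstar s) {A} \<longleftrightarrow>
    (\<exists>P d. invertible P \<and> mstar s P ** A ** P = diag_mat d \<and> (\<exists>M. herm_cone (*) s \<eta> M \<and> (\<forall>i. d i \<in> M)))"
proof
  assume aniso: "anisotropic (**) (mstar s) {A}"
  obtain P d where P: "invertible P" "mstar s P ** A ** P = diag_mat d"
    using hermitian_diagonalisation[OF inv eta_central cond A_hermitian_set] by blast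
  have "anisotropic (**) (mstar s) {diag_mat d}"
    using aniso anisotropic_matrix_congruence[OF inv P(1), of A] P(2) by simp
  moreover have "d j \<in> herm_set (*) s \<eta>" for j
    using hermitian_entry[OF inv eta_central hermitian_congruence[OF inv eta_central A_hermitian_set],
        of P j j] P(2)
    by (simp add: herm_set_def diag_mat_def)
  ultimately show "\<exists>P d. invertible P \<and> mstar s P ** A ** P = diag_mat d \<and>
      (\<exists>M. herm_cone (*) s \<eta> M \<and> (\<forall>i. d i \<in> M))"
    using cone_of_diagonal[OF inv eta_central] P by blast
next
  assume "\<exists>P d. invertible P \<and> mstar s P ** A ** P = diag_mat d \<and>
      (\<exists>M. herm_cone (*) s \<eta> M \<and> (\<forall>i. d i \<in> M))"
  then obtain P d M where P: "invertible P" "mstar s P ** A ** P = diag_mat d"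
    and M: "herm_cone (*) s \<eta> M" "\<And>i. d i \<in> M" by blast
  have "invertible (diag_mat d)"
    using invertible_mult[OF invertible_mult[OF mstar_invertible[OF inv P(1)] A_invertible] P(1)] P(2)
    by simp
  hence nonzero: "d i \<noteq> 0" for i by (rule diag_invertible_nonzero)
  have "anisotropic (**) (mstar s) {diag_mat d}"
    by (rule diagonal_anisotropic[OF inv M(1)]) (fact M(2), fact nonzero)
  thus "anisotropic (**) (mstar s) {A}"
    using anisotropic_matrix_congruence[OF inv P(1), of A] P(2) by simp
qed

end

text \<open>\<open>select_rows I f\<close> has, for \<open>a \<in> I\<close>, the unit vector \<open>e\<^bsub>f a\<^esub>\<close> as row \<open>a\<close> and zero rows
  otherwise; congruence by it extracts the entries \<open>B\<^bsub>f a, f b\<^esub>\<close>.\<close>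
definition select_rows :: "'n::finite set \<Rightarrow> ('n \<Rightarrow> 'n) \<Rightarrow> 'd::ring_1^'n^'n" where
  "select_rows I f = (\<chi> a k. if a \<in> I \<and> k = f a then 1 else 0)"

lemma select_rows_congruence_entry:
  "(select_rows I f ** B ** transpose (select_rows I f)) $ a $ b =
     (if a \<in> I \<and> b \<in> I then B $ f a $ f b else 0)"
proof -
  have row: "(select_rows I f ** B) $ a $ l = (if a \<in> I then B $ f a $ l else 0)" for l
    by (simp add: matrix_matrix_mult_def select_rows_def mult_if_zero sum.delta)
  have "(select_rows I f ** B) $ a $ k * transpose (select_rows I f) $ k $ b =
      (if k = f b then (if a \<in> I \<and> b \<in> I then B $ f a $ f b else 0) else 0)" for k
    unfolding row by (simp add: transpose_def select_rows_def)
  thus ?thesis by (simp add: matrix_matrix_mult_def[of "select_rows I f ** B"] sum.delta')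
qed

context hermitian_form
begin

text \<open>If \<open>\<eta> = -1\<close> and \<open>* = id\<close> then \<open>A\<close> is alternating; for \<open>A\<^sub>i\<^sub>j \<noteq> 0\<close> the two selections of
  rows \<open>(i, j)\<close> and \<open>(j, i)\<close> give congruent copies of \<open>A\<close> that cancel.\<close>
theorem alternating_not_anisotropic:
  assumes char: "(2::'d) \<noteq> 0" and eta: "\<eta> = -1" and sid: "s = id"
  shows "\<not> anisotropic (**) (mstar s) {A}"
proof
  assume aniso: "anisotropic (**) (mstar s) {A}"
  have mstar_transpose: "mstar s X = transpose X" for X
    by (simp add: vec_eq_iff transpose_def mstar_def sid)
  have skew: "A $ a $ b = - A $ b $ a" for a b
    using arg_cong[OF A_hermitian, of "\<lambda>Z. Z $ a $ b"] by (simp add: mat_mult_entry mstar_def eta sid)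
  have diag0: "A $ a $ a = 0" for a
  proof -
    have "2 * A $ a $ a = 0" using skew[of a a] by (simp add: mult_2 eq_neg_iff_add_eq_0)
    thus ?thesis using char by simp
  qed
  have "A \<noteq> 0"
  proof
    assume "A = 0"
    hence "(mat 1 :: 'd^'n^'n) $ i $ i = 0" for i using A_Ai by simp
    thus False by (simp add: mat_def)
  qed
  then obtain i j where ij: "A $ i $ j \<noteq> 0" by (auto simp: vec_eq_iff)
  hence i_ne_j: "i \<noteq> j" using diag0 by auto
  define swap where "swap a = (if a = i then j else i)" for a
  define X1 :: "'d^'n^'n" where "X1 = select_rows {i, j} id"
  define X2 :: "'d^'n^'n" where "X2 = select_rows {i, j} swap"
  have "X1 ** A ** mstar s X1 + X2 ** A ** mstar s X2 = 0"
    using i_ne_j diag0 skew[of i j]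
    by (auto simp: vec_eq_iff X1_def X2_def swap_def mstar_transpose select_rows_congruence_entry)
  hence "sum_list (map (\<lambda>X. X ** A ** mstar s X) [X1, X2]) = 0" by simp
  hence "\<forall>X\<in>set [X1, X2]. X ** A ** mstar s X = 0"
    using aniso unfolding anisotropic_singleton nonvanishing_sums_def by blast
  hence "X1 ** A ** mstar s X1 = 0" by simp
  hence "(X1 ** A ** mstar s X1) $ i $ j = 0" by simp
  thus False using ij by (simp add: X1_def mstar_transpose select_rows_congruence_entry)
qed

end

section \<open>The main theorem\<close>

theorem corollary1p4:
  fixes s :: "'d::division_ring \<Rightarrow> 'd"
    and \<eta> :: 'd
    and A :: "'d^'n::finite^'n"
  assumes char: "(2::'d) \<noteq> 0"
    and fd: "fin_dim_over_center TYPE('d)"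
    and inv: "is_involution s"
    and eta_F: "\<eta> \<in> center"
    and eta_unit: "\<eta> * s \<eta> = 1"
    and A_inv: "invertible A"
    and A_herm: "mat \<eta> ** mstar s A = A"
  shows "((\<eta> \<noteq> -1 \<or> s \<noteq> id) \<longrightarrow>
          ((formally_real (**) (\<lambda>X. matrix_inv A ** mstar s X ** A)
             \<longleftrightarrow> (\<exists>M. herm_cone (**) (\<lambda>X. matrix_inv A ** mstar s X ** A) (mat 1) M
                        \<and> mat 1 \<in> M))
         \<and> (formally_real (**) (\<lambda>X. matrix_inv A ** mstar s X ** A)
             \<longleftrightarrow> (\<exists>M. herm_cone (**) (mstar s) (mat \<eta>) M \<and> A \<in> M))
         \<and> (formally_real (**) (\<lambda>X. matrix_inv A ** mstar s X ** A)
             \<longleftrightarrow> (\<exists>P d. invertible P \<and> mstar s P ** A ** P = diag_mat d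
                   \<and> (\<exists>M. herm_cone (*) s \<eta> M \<and> (\<forall>i. d i \<in> M))))))
       \<and> ((\<eta> = -1 \<and> s = id) \<longrightarrow>
          \<not> formally_real (**) (\<lambda>X. matrix_inv A ** mstar s X ** A))"
proof -
  interpret hermitian_form s \<eta> A
    using inv eta_F eta_unit A_inv A_herm by unfold_locales
  have sharp: "(\<lambda>X. matrix_inv A ** mstar s X ** A) = sharp" by (simp add: fun_eq_iff sharp_def)
  have formally_real_sharp: "formally_real (**) sharp \<longleftrightarrow> anisotropic (**) sharp {mat 1}"
    by (rule ring_involution.formally_real_iff_anisotropic[OF ring_involution_sharp])
  have "mat 1 \<in> herm_set (**) sharp (mat 1)"
    using ring_involution.J_one[OF ring_involution_sharp] by (simp add: herm_set_def)
  hence cone_1: "anisotropic (**) sharp {mat 1} \<longleftrightarrow> (\<exists>M. herm_cone (**) sharp (mat 1) M \<and> mat 1 \<in> M)"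
    using ring_involution.cone_iff_anisotropic[OF ring_involution_sharp, of "mat 1" "{mat 1}"] by simp
  have cone_A: "anisotropic (**) (mstar s) {A} \<longleftrightarrow> (\<exists>M. herm_cone (**) (mstar s) (mat \<eta>) M \<and> A \<in> M)"
    using ring_involution.cone_iff_anisotropic[OF ring_involution_mstar[OF inv] mat_eta_central, of "{A}"]
      A_hermitian_set by auto
  show ?thesis
    unfolding sharp formally_real_sharp sharp_anisotropic_iff
    using cone_1 cone_A anisotropic_iff_diagonal_cone alternating_not_anisotropic[OF char]
    by (simp add: sharp_anisotropic_iff)
qed

end
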